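(* Let $a,b>0$ and consider the billiard in the ellipse $E=\{(x,y)\in\mathbb{R}^2:\ x^2/a^2+y^2/b^2=1\}$, whose center is the origin $O$. For every 3-periodic billiard trajectory in $E$, with vertices $P_1,P_2,P_3\in E$, the Mittenpunkt $X_9$ of the triangle $P_1P_2P_3$ is the center $O$. That is, over the whole family of 3-periodic trajectories, the Mittenpunkt is stationary at the center of the ellipse.
   Context: Elliptic billiard: a particle moves in straight lines at constant speed inside $E$ and bounces elastically on $E$, i.e. at each bounce point the incoming and outgoing segments make equal angles with the normal to $E$. A 3-periodic trajectory (orbit) is a closed billiard trajectory with three bounce points, that is, a non-degenerate triangle $P_1P_2P_3$ inscribed in $E$ such that at each vertex the normal to $E$ bisects the interior angle of the triangle. Excentral triangle of $P_1P_2P_3$: through each $P_i$ draw the line perpendicular to the interior angle bisector at $P_i$; the three pairwise intersections of these lines are the excenters $P_1',P_2',P_3'$, where $P_i'$ is the excenter opposite to $P_i$ (the intersection of the lines through the other two vertices). Mittenpunkt $X_9$: the common point of the three lines joining each excenter $P_i'$ to the midpoint of the side of $P_1P_2P_3$ opposite to $P_i$. *)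

theory Defs
  imports "HOL-Analysis.Analysis"
begin

type_synonym point = "real \<times> real"

definition ellipse :: "real \<Rightarrow> real \<Rightarrow> point set" where
  "ellipse a b = {(x, y). x\<^sup>2 / a\<^sup>2 + y\<^sup>2 / b\<^sup>2 = 1}"

definition ellipse_normal :: "real \<Rightarrow> real \<Rightarrow> point \<Rightarrow> point" where
  "ellipse_normal a b P = (2 * fst P / a\<^sup>2, 2 * snd P / b\<^sup>2)"

text \<open>The vector above is the gradient of the function of which the ellipse is a level set, and it
  does not vanish on the ellipse.\<close>

lemma ellipse_normal_gradient:
  "GDERIV (\<lambda>P. (fst P)\<^sup>2 / a\<^sup>2 + (snd P)\<^sup>2 / b\<^sup>2) P :> ellipse_normal a b P"
  unfolding gderiv_def ellipse_normal_def divide_inverse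
  by (auto intro!: derivative_eq_intros ext simp: inner_prod_def algebra_simps)

lemma ellipse_normal_nonzero:
  assumes "P \<in> ellipse a b"
  shows "ellipse_normal a b P \<noteq> 0"
  using assms by (auto simp: ellipse_def ellipse_normal_def zero_prod_def)

definition normal_line :: "real \<Rightarrow> real \<Rightarrow> point \<Rightarrow> point set" where
  "normal_line a b P = {P + t *\<^sub>R ellipse_normal a b P |t. t \<in> UNIV}"

text \<open>Unoriented angle \<open>BAC\<close> in \<open>[0, \<pi>]\<close>, with vertex \<open>A\<close> (the middle argument).\<close>

definition angle :: "point \<Rightarrow> point \<Rightarrow> point \<Rightarrow> real" where
  "angle B A C = arccos (((B - A) \<bullet> (C - A)) / (norm (B - A) * norm (C - A)))"

text \<open>The bisector of the interior angle \<open>BAC\<close>, as a closed ray from \<open>A\<close>. The bisecting line is its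
  affine hull.\<close>

definition interior_bisector :: "point \<Rightarrow> point \<Rightarrow> point \<Rightarrow> point set" where
  "interior_bisector B A C =
     {Q. Q = A \<or> (angle B A Q = angle B A C / 2 \<and> angle Q A C = angle B A C / 2)}"

definition exterior_bisector :: "point \<Rightarrow> point \<Rightarrow> point \<Rightarrow> point set" where
  "exterior_bisector B A C = {X. \<forall>Q\<in>interior_bisector B A C. orthogonal (X - A) (Q - A)}"

definition billiard_3_orbit :: "real \<Rightarrow> real \<Rightarrow> point \<Rightarrow> point \<Rightarrow> point \<Rightarrow> bool" where
  "billiard_3_orbit a b P1 P2 P3 \<longleftrightarrow>
     P1 \<in> ellipse a b \<and> P2 \<in> ellipse a b \<and> P3 \<in> ellipse a b \<and>
     \<not> collinear {P1, P2, P3} \<and>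
     normal_line a b P1 = affine hull (interior_bisector P2 P1 P3) \<and>
     normal_line a b P2 = affine hull (interior_bisector P3 P2 P1) \<and>
     normal_line a b P3 = affine hull (interior_bisector P1 P3 P2)"

text \<open>\<open>J\<close> is the excenter of the triangle \<open>ABC\<close> opposite to \<open>A\<close>.\<close>

definition is_excenter :: "point \<Rightarrow> point \<Rightarrow> point \<Rightarrow> point \<Rightarrow> bool" where
  "is_excenter A B C J \<longleftrightarrow> exterior_bisector C B A \<inter> exterior_bisector A C B = {J}"

text \<open>A relation rather than a function, so that asserting it includes the existence and uniqueness
  of the excenters and of the common point.\<close>

definition is_mittenpunkt :: "point \<Rightarrow> point \<Rightarrow> point \<Rightarrow> point \<Rightarrow> bool" where
  "is_mittenpunkt P1 P2 P3 M \<longleftrightarrow>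
     (\<exists>J1 J2 J3. is_excenter P1 P2 P3 J1 \<and> is_excenter P2 P3 P1 J2 \<and> is_excenter P3 P1 P2 J3 \<and>
        affine hull {J1, midpoint P2 P3} \<inter> affine hull {J2, midpoint P3 P1} \<inter>
        affine hull {J3, midpoint P1 P2} = {M})"

end

theory Submission imports Defs begin

text \<open>At each vertex the exterior bisector is the tangent to the ellipse. Hence the excenter opposite
  to a vertex is the pole of the opposite side, and the line joining the pole of a chord to the
  midpoint of the chord passes through the center. The bisector condition is needed once more to
  exclude that a side is a diameter, which has no pole: then the normals at its endpoints would be
  parallel, but two interior bisectors of a triangle are not.\<close>

section \<open>Bisectors described by the direction of a line\<close>

text \<open>A subset of \<open>{A}\<close> has its affine hull inside \<open>{A}\<close>, whereas a
  line with direction \<open>n\<close> has a second point. This recovers an actual point of the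
  bisector from a hypothesis on its affine hull only.\<close>

lemma interior_bisector_on_line:
  assumes line: "{A + t *\<^sub>R n |t. t \<in> UNIV} = affine hull (interior_bisector B A C)" and "n \<noteq> 0"
  obtains t where "t \<noteq> 0" "A + t *\<^sub>R n \<in> interior_bisector B A C"
proof -
  have "\<not> interior_bisector B A C \<subseteq> {A}"
  proof
    assume "interior_bisector B A C \<subseteq> {A}"
    then have "affine hull (interior_bisector B A C) \<subseteq> {A}"
      by (simp add: hull_minimal)
    moreover have "A + 1 *\<^sub>R n \<in> affine hull (interior_bisector B A C)"
      using line by blast
    ultimately show False
      using \<open>n \<noteq> 0\<close> by auto
  qed
  then obtain Q where Q: "Q \<in> interior_bisector B A C" "Q \<noteq> A"
    by blast
  then have "Q \<in> {A + t *\<^sub>R n |t. t \<in> UNIV}"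
    unfolding line by (simp add: hull_inc)
  then show thesis
    using Q that by auto
qed

text \<open>The bisector lies on the line and contains a point of it other than \<open>A\<close>, so
  orthogonality to all of it amounts to orthogonality to \<open>n\<close>.\<close>

lemma exterior_bisector_eq:
  assumes line: "{A + t *\<^sub>R n |t. t \<in> UNIV} = affine hull (interior_bisector B A C)" and "n \<noteq> 0"
  shows "exterior_bisector B A C = {X. (X - A) \<bullet> n = 0}"
proof -
  obtain t where t: "t \<noteq> 0" "A + t *\<^sub>R n \<in> interior_bisector B A C"
    using interior_bisector_on_line[OF assms] .
  have "interior_bisector B A C \<subseteq> {A + t *\<^sub>R n |t. t \<in> UNIV}"
    unfolding line by (rule hull_subset)
  then have "orthogonal (X - A) (Q - A)"
    if "(X - A) \<bullet> n = 0" "Q \<in> interior_bisector B A C" for X Q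
    using that by (force simp: orthogonal_def)
  moreover have "(X - A) \<bullet> n = 0" if "X \<in> exterior_bisector B A C" for X
    using that t by (force simp: exterior_bisector_def orthogonal_def)
  ultimately show ?thesis
    by (auto simp: exterior_bisector_def)
qed

lemma cos_angle:
  "cos (angle B A C) = ((B - A) \<bullet> (C - A)) / (norm (B - A) * norm (C - A))"
proof -
  have "\<bar>((B - A) \<bullet> (C - A)) / (norm (B - A) * norm (C - A))\<bar> \<le> 1"
    using Cauchy_Schwarz_ineq2[of "B - A" "C - A"]
    by (simp add: abs_mult) (metis divide_le_eq_1 less_eq_real_def mult_nonneg_nonneg norm_ge_zero)
  then show ?thesis
    unfolding angle_def by (simp add: cos_arccos_abs)
qed

text \<open>Taking cosines turns the equality of the two half angles into an equation linear in
  \<open>n\<close>.\<close>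

lemma interior_bisector_sgn_inner:
  assumes line: "{A + t *\<^sub>R n |t. t \<in> UNIV} = affine hull (interior_bisector B A C)" and "n \<noteq> 0"
  shows "sgn (B - A) \<bullet> n = sgn (C - A) \<bullet> n"
proof -
  obtain t where t: "t \<noteq> 0" "A + t *\<^sub>R n \<in> interior_bisector B A C"
    using interior_bisector_on_line[OF assms] .
  then have "angle B A (A + t *\<^sub>R n) = angle B A C / 2" "angle (A + t *\<^sub>R n) A C = angle B A C / 2"
    using \<open>n \<noteq> 0\<close> by (simp_all add: interior_bisector_def)
  then have "cos (angle B A (A + t *\<^sub>R n)) = cos (angle (A + t *\<^sub>R n) A C)"
    by (simp only:)
  \<comment> \<open>The sign of \<open>t\<close> is unknown, as \<open>n\<close> may point to either
    side of \<open>A\<close>; it sits in a common nonzero factor and cancels.\<close>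
  then have "(t / (\<bar>t\<bar> * norm n)) * (sgn (B - A) \<bullet> n) = (t / (\<bar>t\<bar> * norm n)) * (sgn (C - A) \<bullet> n)"
    by (simp add: cos_angle sgn_div_norm inner_commute divide_inverse mult_ac)
  then show ?thesis
    using t \<open>n \<noteq> 0\<close> by simp
qed

section \<open>Bisectors of a triangle are not parallel\<close>

text \<open>In the plane, a line perpendicular to \<open>n\<close> meets the unit circle in at most
  two points.\<close>

lemma unit_vectors_same_component:
  fixes u v w n :: point
  assumes "norm u = 1" "norm v = 1" "norm w = 1" and "n \<noteq> 0"
    and "u \<bullet> n = v \<bullet> n" "u \<bullet> n = w \<bullet> n" and "u \<noteq> v" "u \<noteq> w"
  shows "v = w"
proof -
  \<comment> \<open>\<open>u - z\<close> is orthogonal to \<open>n\<close> and, the norms being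
    equal, to \<open>u + z\<close>; in the plane this makes \<open>u + z\<close> parallel to
    \<open>n\<close>.\<close>
  have par: "(fst u + fst z) * snd n = (snd u + snd z) * fst n"
    if "norm z = 1" "u \<bullet> n = z \<bullet> n" "u \<noteq> z" for z :: point
  proof -
    have 1: "(fst u - fst z) * fst n + (snd u - snd z) * snd n = 0"
      using that by (simp add: inner_prod_def algebra_simps)
    have "u \<bullet> u = z \<bullet> z"
      using that assms by (simp add: dot_square_norm)
    then have 2: "(fst u - fst z) * (fst u + fst z) + (snd u - snd z) * (snd u + snd z) = 0"
      by (simp add: inner_prod_def algebra_simps)
    have "fst u - fst z \<noteq> 0 \<or> snd u - snd z \<noteq> 0"
      using that by (auto simp: prod_eq_iff)
    moreover have "(fst u - fst z) * ((fst u + fst z) * snd n - (snd u + snd z) * fst n) = 0"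
      using 1 2 by algebra
    moreover have "(snd u - snd z) * ((fst u + fst z) * snd n - (snd u + snd z) * fst n) = 0"
      using 1 2 by algebra
    ultimately show ?thesis
      by auto
  qed
  \<comment> \<open>Subtracting two instances of \<open>par\<close> shows \<open>v - w\<close>
    parallel to \<open>n\<close>; it is also orthogonal to \<open>n\<close>, hence zero.\<close>
  have "(fst v - fst w) * snd n = (snd v - snd w) * fst n"
    using par[of v] par[of w] assms by (simp add: algebra_simps)
  moreover have "(fst v - fst w) * fst n + (snd v - snd w) * snd n = 0"
    using assms by (simp add: inner_prod_def algebra_simps)
  ultimately have "(fst v - fst w) * ((fst n)\<^sup>2 + (snd n)\<^sup>2) = 0"
    and "(snd v - snd w) * ((fst n)\<^sup>2 + (snd n)\<^sup>2) = 0"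
    by algebra+
  moreover have "(fst n)\<^sup>2 + (snd n)\<^sup>2 \<noteq> 0"
    using \<open>n \<noteq> 0\<close> by (simp add: sum_power2_eq_zero_iff prod_eq_iff)
  ultimately have "fst v - fst w = 0" "snd v - snd w = 0"
    by (metis mult_eq_0_iff)+
  then show ?thesis
    by (simp add: prod_eq_iff)
qed

lemma collinear_if_differences_parallel:
  assumes "Y - X = c *\<^sub>R d" "Z - X = e *\<^sub>R d"
  shows "collinear {X, Y, Z}"
proof -
  have "X = X + 0 *\<^sub>R d" "Y = X + c *\<^sub>R d" "Z = X + e *\<^sub>R d"
    using assms by (simp_all add: algebra_simps)
  then show ?thesis
    unfolding collinear_alt by blast
qed

lemma norm_scaleR_sgn: "norm x *\<^sub>R sgn x = (x :: 'a::real_normed_vector)"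
  by (cases "x = 0") (simp_all add: sgn_div_norm)

text \<open>The unit side vectors, suitably oriented, would all have the same component along \<open>n\<close>, but at
  most two unit vectors of the plane do.\<close>

lemma interior_bisectors_not_parallel:
  fixes A B C n :: point
  assumes "\<not> collinear {A, B, C}" and "n \<noteq> 0"
    and A: "sgn (B - A) \<bullet> n = sgn (C - A) \<bullet> n"
    and B: "sgn (A - B) \<bullet> n = sgn (C - B) \<bullet> n"
  shows False
proof -
  have ne: "A \<noteq> B" "A \<noteq> C" "B \<noteq> C"
    using assms(1) by (auto simp: insert_commute)
  have minus: "sgn (X - Y) = - sgn (Y - X)" for X Y :: point
    using sgn_minus[of "Y - X"] by simp
  have 1: "sgn (B - A) \<noteq> sgn (C - A)"
    using collinear_if_differences_parallel[OF norm_scaleR_sgn[of "B - A", symmetric], of C "norm (C - A)"]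
      norm_scaleR_sgn[of "C - A"] assms(1) by auto
  have 2: "sgn (B - A) \<noteq> sgn (B - C)"
    using collinear_if_differences_parallel[OF norm_scaleR_sgn[of "A - B", symmetric], of C "norm (C - B)"]
      norm_scaleR_sgn[of "C - B"] assms(1) minus[of B A] minus[of B C] by (auto simp: insert_commute)
  \<comment> \<open>Negating equation \<open>B\<close> gives \<open>sgn (B - A)\<close> and
    \<open>sgn (B - C)\<close> the same component along \<open>n\<close>, so
    \<open>sgn (B - A)\<close> links it to equation \<open>A\<close>.\<close>
  have "sgn (C - A) = sgn (B - C)"
    using unit_vectors_same_component[of "sgn (B - A)" "sgn (C - A)" "sgn (B - C)" n] A B 1 2 ne \<open>n \<noteq> 0\<close>
      minus[of B A] minus[of B C] by (simp add: norm_sgn)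
  then have "collinear {C, A, B}"
    using collinear_if_differences_parallel[of A C "- norm (C - A)" "sgn (C - A)" B "norm (B - C)"]
      norm_scaleR_sgn[of "C - A"] norm_scaleR_sgn[of "B - C"] by simp
  then show False
    using assms(1) by (simp add: insert_commute)
qed

section \<open>Polarity with respect to the ellipse\<close>

text \<open>The polar line of \<open>P\<close> is \<open>{X. polar a b X P = 1}\<close>; it is the tangent when \<open>P\<close> lies on the
  ellipse.\<close>

definition polar :: "real \<Rightarrow> real \<Rightarrow> point \<Rightarrow> point \<Rightarrow> real" where
  "polar a b P Q = fst P * fst Q / a\<^sup>2 + snd P * snd Q / b\<^sup>2"

lemma ellipse_iff_polar: "P \<in> ellipse a b \<longleftrightarrow> polar a b P P = 1"
  by (cases P) (simp add: ellipse_def polar_def power2_eq_square)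

lemma polar_commute: "polar a b P Q = polar a b Q P"
  by (simp add: polar_def mult.commute)

lemma polar_add_left: "polar a b (P + Q) R = polar a b P R + polar a b Q R"
  by (simp add: polar_def add_divide_distrib distrib_right)

lemma polar_diff_left: "polar a b (P - Q) R = polar a b P R - polar a b Q R"
  by (simp add: polar_def diff_divide_distrib left_diff_distrib)

lemma polar_scale_left: "polar a b (c *\<^sub>R P) R = c * polar a b P R"
  by (simp add: polar_def distrib_left)

lemma inner_ellipse_normal: "X \<bullet> ellipse_normal a b P = 2 * polar a b X P"
  by (simp add: polar_def ellipse_normal_def inner_prod_def mult_ac)

lemma polar_self_eq_0_iff:
  assumes "a > 0" "b > 0"
  shows "polar a b P P = 0 \<longleftrightarrow> P = 0"
proof -
  have "polar a b P P = (fst P / a)\<^sup>2 + (snd P / b)\<^sup>2"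
    by (simp add: polar_def power2_eq_square)
  then show ?thesis
    using assms by (simp add: sum_power2_eq_zero_iff prod_eq_iff)
qed

text \<open>\<open>P - Q\<close> and \<open>P + Q\<close> paired with themselves give
  \<open>2 - 2 * polar a b P Q\<close> and \<open>2 + 2 * polar a b P Q\<close>, and the form is
  definite.\<close>

lemma polar_chord:
  assumes "a > 0" "b > 0" "P \<in> ellipse a b" "Q \<in> ellipse a b"
  shows "polar a b P Q = 1 \<longleftrightarrow> P = Q" and "polar a b P Q = - 1 \<longleftrightarrow> P + Q = 0"
proof -
  note bilinear = polar_add_left polar_diff_left polar_commute[of a b _ "P + Q"]
    polar_commute[of a b _ "P - Q"] polar_commute[of a b Q P]
  have on: "polar a b P P = 1" "polar a b Q Q = 1"
    using assms by (simp_all add: ellipse_iff_polar)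
  have "polar a b (P - Q) (P - Q) = 2 - 2 * polar a b P Q"
    using on by (simp add: bilinear)
  then show "polar a b P Q = 1 \<longleftrightarrow> P = Q"
    using polar_self_eq_0_iff[OF assms(1,2), of "P - Q"] by auto
  have "polar a b (P + Q) (P + Q) = 2 + 2 * polar a b P Q"
    using on by (simp add: bilinear)
  then show "polar a b P Q = - 1 \<longleftrightarrow> P + Q = 0"
    using polar_self_eq_0_iff[OF assms(1,2), of "P + Q"] by linarith
qed

text \<open>Pairing \<open>P + Q\<close> with \<open>P\<close> or \<open>Q\<close> gives
  \<open>1 + polar a b P Q\<close>, whence the scaling of the pole. Uniqueness rests on the linear
  independence of \<open>P\<close> and \<open>Q\<close>.\<close>

lemma tangents_meet:
  assumes "a > 0" "b > 0" "P \<in> ellipse a b" "Q \<in> ellipse a b" "P \<noteq> Q" "P + Q \<noteq> 0"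
  shows "{X. polar a b X P = 1} \<inter> {X. polar a b X Q = 1} = {(1 / (1 + polar a b P Q)) *\<^sub>R (P + Q)}"
    (is "_ = {?J}")
proof -
  have on: "polar a b P P = 1" "polar a b Q Q = 1"
    using assms by (simp_all add: ellipse_iff_polar)
  have nz: "polar a b P Q \<noteq> 1" "polar a b P Q \<noteq> - 1"
    using polar_chord[OF assms(1-4)] assms(5,6) by auto
  then have pole: "polar a b ?J P = 1" "polar a b ?J Q = 1"
    using on by (auto simp: polar_add_left polar_scale_left polar_commute[of a b Q P] field_simps)
  have "X = ?J" if "polar a b X P = 1" "polar a b X Q = 1" for X
  proof -
    define D where "D = X - ?J"
    have D: "polar a b D P = 0" "polar a b D Q = 0"
      using that pole by (simp_all add: D_def polar_diff_left)
    define \<delta> where "\<delta> = fst P * snd Q - snd P * fst Q"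
    \<comment> \<open>Gram determinant of \<open>P\<close> and \<open>Q\<close> for the form; here
      it equals \<open>1 - (polar a b P Q)\<^sup>2\<close>, which is nonzero by
      \<open>nz\<close>.\<close>
    have gram: "\<delta>\<^sup>2 / (a\<^sup>2 * b\<^sup>2) = polar a b P P * polar a b Q Q - (polar a b P Q)\<^sup>2"
      using assms(1,2) by (simp add: \<delta>_def polar_def field_simps power2_eq_square)
    have "\<delta> \<noteq> 0"
      using gram on nz by (auto simp: power2_eq_1_iff)
    \<comment> \<open>Cramer's rule for the two linear equations on \<open>D\<close>.\<close>
    have "\<delta> * (fst D / a\<^sup>2) = snd Q * polar a b D P - snd P * polar a b D Q"
      "\<delta> * (snd D / b\<^sup>2) = fst P * polar a b D Q - fst Q * polar a b D P"
      by (simp_all add: \<delta>_def polar_def algebra_simps)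
    then have "D = 0"
      using D \<open>\<delta> \<noteq> 0\<close> assms(1,2) by (simp add: prod_eq_iff)
    then show ?thesis
      by (simp add: D_def)
  qed
  then show ?thesis
    using pole by blast
qed

section \<open>Excenters of an orbit and their lines to the side midpoints\<close>

lemma billiard_3_orbit_rotate:
  "billiard_3_orbit a b P1 P2 P3 \<Longrightarrow> billiard_3_orbit a b P2 P3 P1"
  by (simp add: billiard_3_orbit_def insert_commute)

lemma affine_hull_multiple:
  fixes M :: "'a::real_vector"
  assumes "c \<noteq> 1"
  shows "affine hull {c *\<^sub>R M, M} = range (\<lambda>t. t *\<^sub>R M)"
proof -
  have "\<exists>u v. t *\<^sub>R M = u *\<^sub>R (c *\<^sub>R M) + v *\<^sub>R M \<and> u + v = 1" for t
  proof -
    \<comment> \<open>The weight that solves \<open>u * c + (1 - u) = t\<close>.\<close>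
    define u where "u = (t - 1) / (c - 1)"
    have "u * c + (1 - u) = u * (c - 1) + 1"
      by (simp add: algebra_simps)
    then have "u * c + (1 - u) = t"
      using assms by (simp add: u_def)
    then have "t *\<^sub>R M = u *\<^sub>R (c *\<^sub>R M) + (1 - u) *\<^sub>R M"
      by (metis scaleR_add_left scaleR_scaleR)
    then show ?thesis
      by (metis add_diff_cancel_left' diff_add_cancel add.commute)
  qed
  moreover have "u *\<^sub>R (c *\<^sub>R M) + v *\<^sub>R M \<in> range (\<lambda>t. t *\<^sub>R M)" for u v
    by (rule image_eqI[of _ _ "u * c + v"]) (simp_all add: scaleR_add_left)
  ultimately show ?thesis
    unfolding affine_hull_2 by auto
qed

text \<open>Orthogonality of \<open>X - P\<close> to the normal at \<open>P\<close> reads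
  \<open>polar a b X P = polar a b P P\<close>, and the right side is 1 on the ellipse.\<close>

lemma billiard_exterior_bisector:
  assumes "P \<in> ellipse a b" "normal_line a b P = affine hull (interior_bisector B P C)"
  shows "exterior_bisector B P C = {X. polar a b X P = 1}"
  using exterior_bisector_eq[of P "ellipse_normal a b P" B C] assms ellipse_normal_nonzero[OF assms(1)]
  by (simp add: normal_line_def inner_ellipse_normal polar_diff_left ellipse_iff_polar)

text \<open>The pole and the midpoint of the side are both multiples of \<open>P2 + P3\<close>, so
  the line joining them is spanned by that vector.\<close>

lemma billiard_excenter:
  assumes "a > 0" "b > 0" "billiard_3_orbit a b P1 P2 P3"
  obtains J where "is_excenter P1 P2 P3 J"
    "affine hull {J, midpoint P2 P3} = range (\<lambda>t. t *\<^sub>R (P2 + P3))"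
proof -
  have on: "P2 \<in> ellipse a b" "P3 \<in> ellipse a b" and ncol: "\<not> collinear {P1, P2, P3}"
    and n2: "normal_line a b P2 = affine hull (interior_bisector P3 P2 P1)"
    and n3: "normal_line a b P3 = affine hull (interior_bisector P1 P3 P2)"
    using assms(3) by (simp_all add: billiard_3_orbit_def)
  have "P2 \<noteq> P3"
    using ncol by (auto simp: collinear_2)
  let ?n = "ellipse_normal a b"
  have "P2 + P3 \<noteq> 0"
  proof
    assume "P2 + P3 = 0"
    then have "?n P3 = - ?n P2"
      by (auto simp: ellipse_normal_def prod_eq_iff add_eq_0_iff)
    moreover have "sgn (P3 - P2) \<bullet> ?n P2 = sgn (P1 - P2) \<bullet> ?n P2"
      using n2 on by (intro interior_bisector_sgn_inner ellipse_normal_nonzero) (simp_all add: normal_line_def)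
    moreover have "sgn (P1 - P3) \<bullet> ?n P3 = sgn (P2 - P3) \<bullet> ?n P3"
      using n3 on by (intro interior_bisector_sgn_inner ellipse_normal_nonzero) (simp_all add: normal_line_def)
    ultimately show False
      using interior_bisectors_not_parallel[of P2 P3 P1 "?n P2"] ncol on ellipse_normal_nonzero[of P2 a b]
      by (simp add: insert_commute)
  qed
  define k where "k = 1 / (1 + polar a b P2 P3)"
  have "is_excenter P1 P2 P3 (k *\<^sub>R (P2 + P3))"
    unfolding is_excenter_def k_def
    using tangents_meet[OF assms(1,2) on \<open>P2 \<noteq> P3\<close> \<open>P2 + P3 \<noteq> 0\<close>]
      billiard_exterior_bisector[OF on(1) n2] billiard_exterior_bisector[OF on(2) n3] by simp
  moreover have "affine hull {k *\<^sub>R (P2 + P3), midpoint P2 P3} = range (\<lambda>t. t *\<^sub>R (P2 + P3))"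
  proof -
    \<comment> \<open>Otherwise the pole would be the midpoint; but \<open>2 * k = 1\<close> means
      \<open>polar a b P2 P3 = 1\<close>, that is \<open>P2 = P3\<close>.\<close>
    have "2 * k \<noteq> 1"
      using polar_chord[OF assms(1,2) on] \<open>P2 \<noteq> P3\<close> \<open>P2 + P3 \<noteq> 0\<close>
      by (auto simp: k_def field_simps)
    then have "affine hull {(2 * k) *\<^sub>R midpoint P2 P3, midpoint P2 P3} = range (\<lambda>t. t *\<^sub>R midpoint P2 P3)"
      by (rule affine_hull_multiple)
    moreover have "(2 * k) *\<^sub>R midpoint P2 P3 = k *\<^sub>R (P2 + P3)"
      by (simp add: midpoint_def)
    moreover have "range (\<lambda>t. t *\<^sub>R midpoint P2 P3) = range (\<lambda>t. t *\<^sub>R (P2 + P3))"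
    proof -
      have "t *\<^sub>R (P2 + P3) = (2 * t) *\<^sub>R midpoint P2 P3" for t
        by (simp add: midpoint_def)
      moreover have "t *\<^sub>R midpoint P2 P3 = (t / 2) *\<^sub>R (P2 + P3)" for t
        by (simp add: midpoint_def)
      ultimately show ?thesis
        by (metis (no_types, lifting) image_cong rangeI image_subset_iff subset_antisym)
    qed
    ultimately show ?thesis
      by simp
  qed
  ultimately show thesis
    using that by blast
qed

theorem theorem5:
  fixes a b :: real and P1 P2 P3 :: "real \<times> real"
  assumes "a > 0" and "b > 0"
    and "billiard_3_orbit a b P1 P2 P3"
  shows "is_mittenpunkt P1 P2 P3 (0, 0)"
proof -
  note orbit = assms(3) billiard_3_orbit_rotate[OF assms(3)]
    billiard_3_orbit_rotate[OF billiard_3_orbit_rotate[OF assms(3)]]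
  obtain J1 where J1: "is_excenter P1 P2 P3 J1"
    "affine hull {J1, midpoint P2 P3} = range (\<lambda>t. t *\<^sub>R (P2 + P3))"
    using billiard_excenter[OF assms(1,2) orbit(1)] .
  obtain J2 where J2: "is_excenter P2 P3 P1 J2"
    "affine hull {J2, midpoint P3 P1} = range (\<lambda>t. t *\<^sub>R (P3 + P1))"
    using billiard_excenter[OF assms(1,2) orbit(2)] .
  obtain J3 where J3: "is_excenter P3 P1 P2 J3"
    "affine hull {J3, midpoint P1 P2} = range (\<lambda>t. t *\<^sub>R (P1 + P2))"
    using billiard_excenter[OF assms(1,2) orbit(3)] .
  \<comment> \<open>If a common point \<open>X\<close> were nonzero, all pairwise sums of vertices
    would be multiples of \<open>X\<close>, hence so would their differences, making the triangle
    collinear.\<close>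
  have "X = 0" if X: "X = t1 *\<^sub>R (P2 + P3)" "X = t2 *\<^sub>R (P3 + P1)" "X = t3 *\<^sub>R (P1 + P2)" for X t1 t2 t3
  proof (rule ccontr)
    assume "X \<noteq> 0"
    then have nz: "t1 \<noteq> 0" "t2 \<noteq> 0" "t3 \<noteq> 0"
      using X by auto
    have inv: "Y = (1 / t) *\<^sub>R X" if "X = t *\<^sub>R Y" "t \<noteq> 0" for t Y
      using that by simp
    have s: "P2 + P3 = (1 / t1) *\<^sub>R X" "P3 + P1 = (1 / t2) *\<^sub>R X" "P1 + P2 = (1 / t3) *\<^sub>R X"
      by (fact inv[OF X(1) nz(1)] inv[OF X(2) nz(2)] inv[OF X(3) nz(3)])+
    have "P1 - P3 = (P1 + P2) - (P2 + P3)" "P2 - P3 = (P1 + P2) - (P3 + P1)"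
      by simp_all
    then have "P1 - P3 = (1 / t3 - 1 / t1) *\<^sub>R X" "P2 - P3 = (1 / t3 - 1 / t2) *\<^sub>R X"
      unfolding s by (simp_all add: scaleR_left_diff_distrib)
    then have "collinear {P3, P1, P2}"
      by (rule collinear_if_differences_parallel)
    then show False
      using assms(3) by (simp add: billiard_3_orbit_def insert_commute)
  qed
  moreover have "0 \<in> range (\<lambda>t. t *\<^sub>R Y)" for Y :: point
    by (metis rangeI scaleR_zero_left)
  ultimately have "range (\<lambda>t. t *\<^sub>R (P2 + P3)) \<inter> range (\<lambda>t. t *\<^sub>R (P3 + P1)) \<inter> range (\<lambda>t. t *\<^sub>R (P1 + P2)) = {0}"
    by blast
  then show ?thesis
    unfolding is_mittenpunkt_def zero_prod_def[symmetric] using J1 J2 J3 by metis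
qed

end
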